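(* Let $R$ be a commutative ring with $1\neq 0$. Then $\widetilde{\Gamma}(R)$ is complete if and only if at least one of the following holds: $R$ is boolean; or $Z(R)$ is an ideal of $R$; or $R$ is (up to isomorphism) a subring of a product of two integral domains.
   Context: For a commutative ring $R$ with $1\neq 0$, $Z(R)$ denotes the set of zero-divisors of $R$ (including $0$) and $Z(R)^{\star}=Z(R)\setminus\{0\}$. $\widetilde{\Gamma}(R)$ is the undirected simple graph with vertex set $Z(R)^{\star}$ in which distinct vertices $x,y$ are adjacent if and only if $xy=0$ or $x+y\in Z(R)$. A graph is complete if any two distinct vertices are adjacent; a graph with $0$ or $1$ vertices is regarded as complete. A ring is boolean if $x^2=x$ for all its elements $x$. *)

theory Defs
  imports "HOL-Algebra.Algebra"
begin

text \<open>Undirected simple graphs, possibly infinite: an edge is a two-element set of vertices.\<close>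

record 'v sgraph =
  vertices :: "'v set"
  edges :: "'v set set"

definition complete_graph :: "'v sgraph \<Rightarrow> bool"
  where "complete_graph G \<longleftrightarrow>
    (\<forall>x \<in> vertices G. \<forall>y \<in> vertices G. x \<noteq> y \<longrightarrow> {x, y} \<in> edges G)"

text \<open>Only used for commutative rings. If $1 \neq 0$ then $0$ is a zero-divisor.\<close>

definition zero_divisors :: "('a, 'm) ring_scheme \<Rightarrow> 'a set"
  where "zero_divisors R =
    {x \<in> carrier R. \<exists>y \<in> carrier R. y \<noteq> \<zero>\<^bsub>R\<^esub> \<and> x \<otimes>\<^bsub>R\<^esub> y = \<zero>\<^bsub>R\<^esub>}"

definition Gamma_tilde :: "('a, 'm) ring_scheme \<Rightarrow> 'a sgraph"
  where "Gamma_tilde R =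
    \<lparr> vertices = zero_divisors R - {\<zero>\<^bsub>R\<^esub>},
      edges = {{x, y} | x y.
        x \<in> zero_divisors R - {\<zero>\<^bsub>R\<^esub>} \<and> y \<in> zero_divisors R - {\<zero>\<^bsub>R\<^esub>} \<and> x \<noteq> y \<and>
        (x \<otimes>\<^bsub>R\<^esub> y = \<zero>\<^bsub>R\<^esub> \<or> x \<oplus>\<^bsub>R\<^esub> y \<in> zero_divisors R)} \<rparr>"

definition boolean_ring :: "('a, 'm) ring_scheme \<Rightarrow> bool"
  where "boolean_ring R \<longleftrightarrow> ring R \<and> (\<forall>x \<in> carrier R. x [^]\<^bsub>R\<^esub> (2::nat) = x)"

text \<open>
  HOL cannot quantify over the element types of the two domains inside a formula, so they are
  fixed to be \<^typ>\<open>'a set\<close>, the element type of the quotients of \<open>R\<close>.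
  By \<open>subring_of_two_domainsI\<close> below this is no restriction: if \<open>R\<close> is isomorphic to a subring
  of a product of two domains over any element types, then the predicate holds.
\<close>

definition subring_of_two_domains :: "('a, 'm) ring_scheme \<Rightarrow> bool"
  where "subring_of_two_domains R \<longleftrightarrow>
    (\<exists>(D\<^sub>1 :: 'a set ring) (D\<^sub>2 :: 'a set ring) S.
      domain D\<^sub>1 \<and> domain D\<^sub>2 \<and> subring S (RDirProd D\<^sub>1 D\<^sub>2) \<and>
      R \<simeq> (RDirProd D\<^sub>1 D\<^sub>2)\<lparr>carrier := S\<rparr>)"

lemma domain_image_copy:
  fixes R :: "('a, 'm) ring_scheme" and D :: "('b, 'n) ring_scheme"
  assumes "ring R" "domain D" "p \<in> ring_hom R D"
  obtains D' :: "'a set ring" and f :: "'b \<Rightarrow> 'a set"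
  where "domain D'" "f \<circ> p \<in> ring_hom R D'" "inj_on f (p ` carrier R)"
proof -
  interpret R: ring R by fact
  interpret D: domain D by fact
  interpret p: ring_hom_ring R D p
    by (rule ring_hom_ringI2) (use assms in \<open>simp_all add: D.ring_axioms\<close>)
  define K where "K = p ` carrier R"
  have sub: "subring K D"
    unfolding K_def using p.img_is_subring[OF R.carrier_is_subring] .
  have "domain (D\<lparr>carrier := K\<rparr>)"
    by (rule D.subdomain_is_domain) (use sub in \<open>simp add: D.subdomainI' D.subcringI'\<close>)
  then interpret K: "domain" "D\<lparr>carrier := K\<rparr>" .
  define f where "f d = {r \<in> carrier R. p r = d}" for d
  have inj: "inj_on f K"
    by (rule inj_onI) (auto simp: K_def f_def)
  define D' where "D' = image_ring f (D\<lparr>carrier := K\<rparr>)"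
  have "domain D'"
    unfolding D'_def using K.inj_imp_image_ring_is_domain[of f] inj by simp
  moreover have "f \<in> ring_iso (D\<lparr>carrier := K\<rparr>) D'"
    unfolding D'_def using inj_imp_image_ring_iso[of f "D\<lparr>carrier := K\<rparr>"] inj by simp
  then have "f \<in> ring_hom (D\<lparr>carrier := K\<rparr>) D'"
    by (simp add: ring_iso_def)
  moreover have "p \<in> ring_hom R (D\<lparr>carrier := K\<rparr>)"
    using assms(3) by (auto simp: ring_hom_def K_def)
  ultimately show thesis
    using that[of D' f] inj ring_hom_trans unfolding K_def by blast
qed

lemma subring_of_two_domainsI:
  fixes R :: "('a, 'm) ring_scheme"
    and D\<^sub>1 :: "('b, 'n) ring_scheme" and D\<^sub>2 :: "('c, 'k) ring_scheme"
  assumes R: "ring R" and D: "domain D\<^sub>1" "domain D\<^sub>2"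
    and S: "subring S (RDirProd D\<^sub>1 D\<^sub>2)" and iso: "R \<simeq> (RDirProd D\<^sub>1 D\<^sub>2)\<lparr>carrier := S\<rparr>"
  shows "subring_of_two_domains R"
proof -
  obtain h where h: "h \<in> ring_hom R ((RDirProd D\<^sub>1 D\<^sub>2)\<lparr>carrier := S\<rparr>)"
    and bij: "bij_betw h (carrier R) S"
    using iso by (auto simp: is_ring_iso_def ring_iso_def)
  have SD: "S \<subseteq> carrier D\<^sub>1 \<times> carrier D\<^sub>2"
    using subringE(1)[OF S] by (simp add: RDirProd_carrier)
  note prod = RDirProd_def DirProd_def monoid.defs
  have hS: "h x \<in> S" if "x \<in> carrier R" for x
    using that h by (auto simp: ring_hom_def)
  have hD: "fst (h x) \<in> carrier D\<^sub>1" "snd (h x) \<in> carrier D\<^sub>2" if "x \<in> carrier R" for x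
    using subsetD[OF SD, of "h x"] that by (simp_all add: hS mem_Times_iff)
  have p: "fst \<circ> h \<in> ring_hom R D\<^sub>1" "snd \<circ> h \<in> ring_hom R D\<^sub>2"
    using h hD by (auto simp: ring_hom_def prod case_prod_beta)
  obtain E\<^sub>1 :: "'a set ring" and f\<^sub>1 :: "'b \<Rightarrow> 'a set" where
    E1: "domain E\<^sub>1" "f\<^sub>1 \<circ> (fst \<circ> h) \<in> ring_hom R E\<^sub>1" "inj_on f\<^sub>1 ((fst \<circ> h) ` carrier R)"
    using domain_image_copy[OF R D(1) p(1)] by blast
  obtain E\<^sub>2 :: "'a set ring" and f\<^sub>2 :: "'c \<Rightarrow> 'a set" where
    E2: "domain E\<^sub>2" "f\<^sub>2 \<circ> (snd \<circ> h) \<in> ring_hom R E\<^sub>2" "inj_on f\<^sub>2 ((snd \<circ> h) ` carrier R)"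
    using domain_image_copy[OF R D(2) p(2)] by blast
  define g where "g r = (f\<^sub>1 (fst (h r)), f\<^sub>2 (snd (h r)))" for r
  have rE: "ring (RDirProd E\<^sub>1 E\<^sub>2)"
    using E1(1) E2(1) by (intro RDirProd_ring) (simp_all add: domain_def cring_def)
  have g: "g \<in> ring_hom R (RDirProd E\<^sub>1 E\<^sub>2)"
    using E1(2) E2(2) by (auto simp: ring_hom_def prod g_def Pi_iff)
  have inj: "inj_on g (carrier R)"
  proof (rule inj_onI)
    fix x y assume xy: "x \<in> carrier R" "y \<in> carrier R" "g x = g y"
    then have "fst (h x) = fst (h y)" "snd (h x) = snd (h y)"
      using inj_onD[OF E1(3), of "fst (h x)" "fst (h y)"]
        inj_onD[OF E2(3), of "snd (h x)" "snd (h y)"] by (auto simp: g_def)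
    then have "h x = h y" by (simp add: prod_eq_iff)
    then show "x = y" using bij xy by (auto simp: bij_betw_def inj_on_def)
  qed
  interpret g: ring_hom_ring R "RDirProd E\<^sub>1 E\<^sub>2" g
    by (rule ring_hom_ringI2[OF R rE g])
  have "subring (g ` carrier R) (RDirProd E\<^sub>1 E\<^sub>2)"
    using g.img_is_subring[OF ring.carrier_is_subring[OF R]] .
  moreover have "g \<in> ring_iso R ((RDirProd E\<^sub>1 E\<^sub>2)\<lparr>carrier := g ` carrier R\<rparr>)"
    using g inj by (auto simp: ring_iso_def ring_hom_def bij_betw_def)
  ultimately show ?thesis
    unfolding subring_of_two_domains_def is_ring_iso_def using E1(1) E2(1) by blast
qed

end

theory Submission
  imports Defs
begin

text \<open>
  Suppose the graph is complete and \<open>Z(R)\<close> is not an ideal. Then there are zero-divisors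
  \<open>x\<close>, \<open>y\<close> with \<open>x + y\<close> regular, so \<open>x y = 0\<close> and the annihilators of \<open>x\<close> and \<open>y\<close>
  meet in \<open>0\<close>. If both annihilators are prime, \<open>R\<close> embeds into the product of the two quotients.
  Otherwise, say, \<open>ann x\<close> is not prime. In the total quotient ring, \<open>x\<close> and \<open>y\<close> correspond to
  complementary idempotents splitting it as \<open>A \<times> B\<close> where \<open>A\<close> is not a domain. Completeness
  applied to \<open>(u, r)\<close> and \<open>(r - u, 0)\<close>, for a zero-divisor \<open>u\<close> of \<open>A\<close> and a regular \<open>r\<close>,
  gives \<open>u\<^sup>2 = r u\<close>; this makes \<open>A\<close> boolean, and then applied to \<open>(u, b)\<close> and
  \<open>(1 - u, 1 - b)\<close> it makes \<open>B\<close> boolean. The computation can be carried out in \<open>R\<close> itself.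
\<close>

context cring
begin

section \<open>Zero-divisors and regular elements, the latter being those outside
  \<open>zero_divisors R\<close>\<close>

lemma zero_divisorsI:
  "x \<in> carrier R \<Longrightarrow> y \<in> carrier R \<Longrightarrow> y \<noteq> \<zero> \<Longrightarrow> x \<otimes> y = \<zero> \<Longrightarrow> x \<in> zero_divisors R"
  by (auto simp: zero_divisors_def)

lemma zero_divisors_closed: "x \<in> zero_divisors R \<Longrightarrow> x \<in> carrier R"
  by (simp add: zero_divisors_def)

lemma regular_cancel:
  "r \<in> carrier R \<Longrightarrow> r \<notin> zero_divisors R \<Longrightarrow> z \<in> carrier R \<Longrightarrow> r \<otimes> z = \<zero> \<Longrightarrow> z = \<zero>"
  by (auto simp: zero_divisors_def)

lemma regular_cancel_eq:
  assumes "r \<in> carrier R" "r \<notin> zero_divisors R" "a \<in> carrier R" "b \<in> carrier R"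
    and "r \<otimes> a = r \<otimes> b"
  shows "a = b"
proof -
  have "r \<otimes> (a \<ominus> b) = r \<otimes> a \<ominus> r \<otimes> b"
    using assms(1,3,4) by algebra
  then have "r \<otimes> (a \<ominus> b) = \<zero>"
    using assms by (simp add: r_neg a_minus_def)
  then show ?thesis
    using regular_cancel[of r "a \<ominus> b"] assms by (simp add: r_right_minus_eq)
qed

lemma zero_divisors_mult:
  assumes "a \<in> carrier R" "x \<in> zero_divisors R"
  shows "a \<otimes> x \<in> zero_divisors R"
proof -
  obtain y where "x \<in> carrier R" "y \<in> carrier R" "y \<noteq> \<zero>" "x \<otimes> y = \<zero>"
    using assms(2) by (auto simp: zero_divisors_def)
  then show ?thesis
    using assms(1) by (intro zero_divisorsI[of _ y]) (simp_all add: m_assoc)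
qed

lemma regular_mult:
  assumes "r \<in> carrier R" "r \<notin> zero_divisors R" "s \<in> carrier R" "s \<notin> zero_divisors R"
  shows "r \<otimes> s \<notin> zero_divisors R"
proof
  assume "r \<otimes> s \<in> zero_divisors R"
  then obtain z where z: "z \<in> carrier R" "z \<noteq> \<zero>" "r \<otimes> s \<otimes> z = \<zero>"
    by (auto simp: zero_divisors_def)
  then have "s \<otimes> z = \<zero>"
    using regular_cancel[of r "s \<otimes> z"] assms by (simp add: m_assoc)
  then show False
    using regular_cancel[of s z] assms z by simp
qed

lemma one_regular: "\<one> \<notin> zero_divisors R"
  by (auto simp: zero_divisors_def)

section \<open>Completeness and the ideal condition in terms of sums of zero-divisors\<close>

text \<open>Frees completeness from the restriction to distinct nonzero vertices. The excluded pairs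
  satisfy the disjunction anyway: a product with 0 vanishes, and \<open>x + x = (1 + 1) x\<close> is
  a multiple of a zero-divisor.\<close>

lemma complete_Gamma_tilde_iff:
  "complete_graph (Gamma_tilde R) \<longleftrightarrow>
    (\<forall>x \<in> zero_divisors R. \<forall>y \<in> zero_divisors R. x \<oplus> y \<in> zero_divisors R \<or> x \<otimes> y = \<zero>)"
  (is "?L \<longleftrightarrow> ?R")
proof
  assume L: ?L
  show ?R
  proof (intro ballI)
    fix x y assume xy: "x \<in> zero_divisors R" "y \<in> zero_divisors R"
    note c = xy[THEN zero_divisors_closed]
    consider "x = \<zero> \<or> y = \<zero>" | "x = y" | "x \<noteq> \<zero>" "y \<noteq> \<zero>" "x \<noteq> y" by blast
    then show "x \<oplus> y \<in> zero_divisors R \<or> x \<otimes> y = \<zero>"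
    proof cases
      case 1
      then show ?thesis using c by auto
    next
      case 2
      have "x \<oplus> x = (\<one> \<oplus> \<one>) \<otimes> x" using c by algebra
      then show ?thesis using 2 zero_divisors_mult[of "\<one> \<oplus> \<one>" x] xy by simp
    next
      case 3
      then have "{x, y} \<in> edges (Gamma_tilde R)"
        using L xy by (simp add: complete_graph_def Gamma_tilde_def)
      then obtain a b where "{x, y} = {a, b}" "a \<in> zero_divisors R" "b \<in> zero_divisors R"
        and ab: "a \<otimes> b = \<zero> \<or> a \<oplus> b \<in> zero_divisors R"
        by (auto simp: Gamma_tilde_def)
      then have "x = a \<and> y = b \<or> x = b \<and> y = a" by (simp add: doubleton_eq_iff)
      then show ?thesis using ab c by (auto simp: m_comm a_comm)
    qed
  qed
next
  assume ?R
  then show ?L by (auto simp: complete_graph_def Gamma_tilde_def)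
qed

text \<open>Multiples of zero-divisors, in particular negatives, are zero-divisors, and 0 is one
  because \<open>1 \<noteq> 0\<close>. Only closure under addition can fail.\<close>

lemma ideal_zero_divisors_iff:
  assumes "\<one> \<noteq> \<zero>"
  shows "ideal (zero_divisors R) R \<longleftrightarrow>
    (\<forall>x \<in> zero_divisors R. \<forall>y \<in> zero_divisors R. x \<oplus> y \<in> zero_divisors R)"
    (is "_ \<longleftrightarrow> ?R")
proof
  assume "ideal (zero_divisors R) R"
  then interpret I: ideal "zero_divisors R" R .
  show ?R by (simp add: I.a_closed)
next
  assume add: ?R
  show "ideal (zero_divisors R) R"
  proof (rule idealI[OF ring_axioms])
    show "subgroup (zero_divisors R) (add_monoid R)"
    proof (rule subgroup.intro)
      show "zero_divisors R \<subseteq> carrier (add_monoid R)"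
        using zero_divisors_closed by auto
      show "\<one>\<^bsub>add_monoid R\<^esub> \<in> zero_divisors R"
        using zero_divisorsI[of \<zero> \<one>] assms by simp
      fix x assume x: "x \<in> zero_divisors R"
      have "\<ominus> x = (\<ominus> \<one>) \<otimes> x"
        using zero_divisors_closed[OF x] by algebra
      then have "\<ominus> x \<in> zero_divisors R"
        using zero_divisors_mult[of "\<ominus> \<one>" x] x by simp
      then show "inv\<^bsub>add_monoid R\<^esub> x \<in> zero_divisors R"
        by (simp add: a_inv_def)
    qed (use add in simp)
  next
    fix a x assume *: "a \<in> zero_divisors R" "x \<in> carrier R"
    then show "x \<otimes> a \<in> zero_divisors R" by (simp add: zero_divisors_mult)
    then show "a \<otimes> x \<in> zero_divisors R"
      using * zero_divisors_closed by (simp add: m_comm)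
  qed
qed

section \<open>Sufficiency for boolean rings and for subrings of a product of two domains\<close>

text \<open>With \<open>s = x + y\<close>, the identity \<open>s (1 - s) = 0\<close> makes
  \<open>s\<close> a zero-divisor unless \<open>s = 1\<close>, and then
  \<open>x = x s = x + x y\<close>.\<close>

lemma boolean_sum_or_mult:
  assumes "boolean_ring R" and xy: "x \<in> carrier R" "y \<in> carrier R"
  shows "x \<oplus> y \<in> zero_divisors R \<or> x \<otimes> y = \<zero>"
proof -
  have idem: "a \<otimes> a = a" if "a \<in> carrier R" for a
    using assms(1) that by (auto simp: boolean_ring_def numeral_2_eq_2)
  define s where "s = x \<oplus> y"
  have s: "s \<in> carrier R" using xy by (simp add: s_def)
  show ?thesis
  proof (cases "s = \<one>")
    case True
    have "x \<otimes> s = x \<otimes> x \<oplus> x \<otimes> y"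
      unfolding s_def using xy by algebra
    then have "x \<oplus> x \<otimes> y = x" using True idem[of x] xy by simp
    then show ?thesis using xy add.r_cancel_one[of x "x \<otimes> y"] by simp
  next
    case False
    have "s \<otimes> (\<one> \<ominus> s) = s \<ominus> s \<otimes> s" using s by algebra
    then have "s \<otimes> (\<one> \<ominus> s) = \<zero>" using idem[OF s] s by (simp add: a_minus_def r_neg)
    then have "s \<in> zero_divisors R"
      using False s by (intro zero_divisorsI[of s "\<one> \<ominus> s"]) auto
    then show ?thesis by (simp add: s_def)
  qed
qed

text \<open>A zero-divisor has a zero coordinate: a nonzero element that kills it is nonzero in some
  coordinate, and there the zero-divisor must vanish. If \<open>x\<close> and \<open>y\<close>
  vanish in different coordinates, then \<open>x y = 0\<close>. If they vanish in the same one, so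
  does the sum, but the element that kills it has to come from \<open>R\<close>, not just from the
  product.\<close>

lemma subring_of_two_domains_sum_or_mult:
  assumes "subring_of_two_domains R" and x: "x \<in> zero_divisors R" and y: "y \<in> zero_divisors R"
  shows "x \<oplus> y \<in> zero_divisors R \<or> x \<otimes> y = \<zero>"
proof -
  obtain D\<^sub>1 D\<^sub>2 :: "'a set ring" and S where D: "domain D\<^sub>1" "domain D\<^sub>2"
    and S: "subring S (RDirProd D\<^sub>1 D\<^sub>2)" and iso: "R \<simeq> (RDirProd D\<^sub>1 D\<^sub>2)\<lparr>carrier := S\<rparr>"
    using assms(1) by (auto simp: subring_of_two_domains_def)
  interpret D1: domain D\<^sub>1 by fact
  interpret D2: domain D\<^sub>2 by fact
  note prod = RDirProd_def DirProd_def monoid.defs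
  obtain h where h: "h \<in> ring_hom R ((RDirProd D\<^sub>1 D\<^sub>2)\<lparr>carrier := S\<rparr>)"
    and bij: "bij_betw h (carrier R) S"
    using iso by (auto simp: is_ring_iso_def ring_iso_def)
  have SD: "S \<subseteq> carrier D\<^sub>1 \<times> carrier D\<^sub>2"
    using subringE(1)[OF S] by (simp add: RDirProd_carrier)
  have hS: "h z \<in> S" if "z \<in> carrier R" for z
    using that h by (auto simp: ring_hom_def)
  define p where "p = fst \<circ> h"
  define q where "q = snd \<circ> h"
  have D: "p z \<in> carrier D\<^sub>1" "q z \<in> carrier D\<^sub>2" if "z \<in> carrier R" for z
    using subsetD[OF SD, of "h z"] that by (simp_all add: hS mem_Times_iff p_def q_def)
  have "p \<in> ring_hom R D\<^sub>1" "q \<in> ring_hom R D\<^sub>2"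
    using h D by (auto simp: ring_hom_def prod case_prod_beta p_def q_def)
  then interpret p: ring_hom_ring R D\<^sub>1 p + q: ring_hom_ring R D\<^sub>2 q
    by (auto intro!: ring_hom_ringI2 ring_axioms D1.ring_axioms D2.ring_axioms)
  have eq0: "z = \<zero>" if "z \<in> carrier R" "p z = \<zero>\<^bsub>D\<^sub>1\<^esub>" "q z = \<zero>\<^bsub>D\<^sub>2\<^esub>" for z
  proof -
    have "h z = h \<zero>"
      using that p.hom_zero q.hom_zero by (simp add: prod_eq_iff p_def q_def)
    then show ?thesis
      using bij that(1) by (auto simp: bij_betw_def dest: inj_onD)
  qed
  obtain a where a: "a \<in> carrier R" "a \<noteq> \<zero>" "x \<otimes> a = \<zero>"
    using x by (auto simp: zero_divisors_def)
  obtain b where b: "b \<in> carrier R" "b \<noteq> \<zero>" "y \<otimes> b = \<zero>"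
    using y by (auto simp: zero_divisors_def)
  note c = x[THEN zero_divisors_closed] y[THEN zero_divisors_closed]
  have pa: "p x \<otimes>\<^bsub>D\<^sub>1\<^esub> p a = \<zero>\<^bsub>D\<^sub>1\<^esub>" and qa: "q x \<otimes>\<^bsub>D\<^sub>2\<^esub> q a = \<zero>\<^bsub>D\<^sub>2\<^esub>"
    using a c p.hom_mult[of x a] q.hom_mult[of x a] by simp_all
  have pb: "p y \<otimes>\<^bsub>D\<^sub>1\<^esub> p b = \<zero>\<^bsub>D\<^sub>1\<^esub>" and qb: "q y \<otimes>\<^bsub>D\<^sub>2\<^esub> q b = \<zero>\<^bsub>D\<^sub>2\<^esub>"
    using b c p.hom_mult[of y b] q.hom_mult[of y b] by simp_all
  have px: "p x = \<zero>\<^bsub>D\<^sub>1\<^esub> \<or> p a = \<zero>\<^bsub>D\<^sub>1\<^esub>" and qx: "q x = \<zero>\<^bsub>D\<^sub>2\<^esub> \<or> q a = \<zero>\<^bsub>D\<^sub>2\<^esub>"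
    using D1.integral[OF pa] D2.integral[OF qa] D a c by auto
  have py: "p y = \<zero>\<^bsub>D\<^sub>1\<^esub> \<or> p b = \<zero>\<^bsub>D\<^sub>1\<^esub>" and qy: "q y = \<zero>\<^bsub>D\<^sub>2\<^esub> \<or> q b = \<zero>\<^bsub>D\<^sub>2\<^esub>"
    using D1.integral[OF pb] D2.integral[OF qb] D b c by auto
  have a0: "p a \<noteq> \<zero>\<^bsub>D\<^sub>1\<^esub> \<or> q a \<noteq> \<zero>\<^bsub>D\<^sub>2\<^esub>" and b0: "p b \<noteq> \<zero>\<^bsub>D\<^sub>1\<^esub> \<or> q b \<noteq> \<zero>\<^bsub>D\<^sub>2\<^esub>"
    using eq0 a b by blast+
  have mult0: "z \<otimes> w = \<zero>"
    if "z \<in> carrier R" "w \<in> carrier R" "p z = \<zero>\<^bsub>D\<^sub>1\<^esub> \<or> p w = \<zero>\<^bsub>D\<^sub>1\<^esub>" "q z = \<zero>\<^bsub>D\<^sub>2\<^esub> \<or> q w = \<zero>\<^bsub>D\<^sub>2\<^esub>" for z w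
    using that D by (intro eq0) (auto simp: p.hom_mult q.hom_mult)
  \<comment> \<open>If \<open>x\<close> and \<open>y\<close> share a zero coordinate and
    \<open>x\<close> is nonzero, then \<open>x\<close> is nonzero in the other coordinate, so
    \<open>a\<close> vanishes there. Hence \<open>a\<close> kills \<open>x + y\<close> as
    well.\<close>
  consider "x \<otimes> y = \<zero>" | "p x = \<zero>\<^bsub>D\<^sub>1\<^esub>" "p y = \<zero>\<^bsub>D\<^sub>1\<^esub>" "q a = \<zero>\<^bsub>D\<^sub>2\<^esub>"
    | "q x = \<zero>\<^bsub>D\<^sub>2\<^esub>" "q y = \<zero>\<^bsub>D\<^sub>2\<^esub>" "p a = \<zero>\<^bsub>D\<^sub>1\<^esub>" | "x = \<zero>" | "y = \<zero>"
    using px py qx qy a0 b0 mult0[OF c] eq0[OF c(1)] eq0[OF c(2)] by blast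
  then show ?thesis
  proof cases
    case 2
    then have "(x \<oplus> y) \<otimes> a = \<zero>"
      using c a D by (intro mult0) (auto simp: p.hom_add)
    then show ?thesis using a c by (blast intro: zero_divisorsI)
  next
    case 3
    then have "(x \<oplus> y) \<otimes> a = \<zero>"
      using c a D by (intro mult0) (auto simp: q.hom_add)
    then show ?thesis using a c by (blast intro: zero_divisorsI)
  qed (use c in auto)
qed

section \<open>Embedding by two prime ideals; annihilators\<close>

text \<open>The map \<open>g\<close> into the product of the two quotients, which are domains, has
  kernel \<open>P \<inter> Q\<close>, so it is injective.\<close>

lemma subring_of_two_domains_quotients:
  assumes "primeideal P R" "primeideal Q R" and PQ: "P \<inter> Q = {\<zero>}"
  shows "subring_of_two_domains R"
proof -
  interpret P: primeideal P R by fact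
  interpret Q: primeideal Q R by fact
  let ?D = "RDirProd (R Quot P) (R Quot Q)"
  define g where "g r = (P +> r, Q +> r)" for r
  note prod = RDirProd_def DirProd_def monoid.defs
  have g: "g \<in> ring_hom R ?D"
    using P.rcos_ring_hom Q.rcos_ring_hom by (auto simp: ring_hom_def prod g_def Pi_iff)
  have inj: "inj_on g (carrier R)"
  proof (rule inj_onI)
    fix x y assume xy: "x \<in> carrier R" "y \<in> carrier R" "g x = g y"
    then have "x \<ominus> y \<in> P" "x \<ominus> y \<in> Q"
      using quotient_eq_iff_same_a_r_cos[OF P.ideal_axioms] quotient_eq_iff_same_a_r_cos[OF Q.ideal_axioms]
      by (auto simp: g_def)
    then have "x \<ominus> y = \<zero>" using PQ by auto
    then show "x = y" using xy by simp
  qed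
  have rD: "ring ?D"
    by (intro RDirProd_ring P.quotient_is_ring Q.quotient_is_ring)
  interpret g: ring_hom_ring R ?D g
    by (rule ring_hom_ringI2[OF ring_axioms rD g])
  have "subring (g ` carrier R) ?D"
    using g.img_is_subring[OF carrier_is_subring] .
  moreover have "g \<in> ring_iso R (?D\<lparr>carrier := g ` carrier R\<rparr>)"
    using g inj by (auto simp: ring_iso_def ring_hom_def bij_betw_def)
  ultimately show ?thesis
    using P.quotient_is_domain Q.quotient_is_domain
    by (intro subring_of_two_domainsI[OF ring_axioms]) (auto simp: is_ring_iso_def)
qed

lemma annihilator_ideal:
  assumes x: "x \<in> carrier R"
  shows "ideal {a \<in> carrier R. a \<otimes> x = \<zero>} R"
proof (rule idealI[OF ring_axioms])
  show "subgroup {a \<in> carrier R. a \<otimes> x = \<zero>} (add_monoid R)"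
    using x by (intro add.subgroupI) (auto simp: l_distr l_minus)
  fix a b assume *: "a \<in> {a \<in> carrier R. a \<otimes> x = \<zero>}" "b \<in> carrier R"
  then show "b \<otimes> a \<in> {a \<in> carrier R. a \<otimes> x = \<zero>}" using x by (simp add: m_assoc)
  then show "a \<otimes> b \<in> {a \<in> carrier R. a \<otimes> x = \<zero>}" using * by (simp add: m_comm)
qed

section \<open>A non-prime annihilator makes the ring boolean\<close>

text \<open>For regular \<open>r\<close>, \<open>y r + u\<close> is killed by \<open>v\<close> and
  \<open>x r - u\<close> by \<open>y\<close>, while their sum \<open>r (x + y)\<close> is regular.
  So completeness makes their product zero, which amounts to \<open>u u = r (x + y) u\<close>.
  Comparing this with the case \<open>r = 1\<close> and cancelling \<open>x + y\<close> gives
  \<open>r u = u\<close>; finally \<open>u u = (x + y) u = u\<close>, as \<open>x + y\<close> is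
  itself regular.\<close>

lemma idempotent_of_complete:
  assumes compl: "complete_graph (Gamma_tilde R)"
    and xy: "x \<in> carrier R" "y \<in> carrier R" "x \<otimes> y = \<zero>" "y \<noteq> \<zero>"
    and s: "x \<oplus> y \<notin> zero_divisors R"
    and uv: "u \<in> carrier R" "v \<in> carrier R" "u \<otimes> y = \<zero>" "v \<otimes> y = \<zero>" "u \<otimes> v = \<zero>" "v \<noteq> \<zero>"
  shows "u \<otimes> u = u" and "\<And>r. r \<in> carrier R \<Longrightarrow> r \<notin> zero_divisors R \<Longrightarrow> r \<otimes> u = u"
proof -
  let ?s = "x \<oplus> y"
  have eq: "u \<otimes> u = r \<otimes> (?s \<otimes> u)" if r: "r \<in> carrier R" "r \<notin> zero_divisors R" for r
  proof -
    have "(y \<otimes> r \<oplus> u) \<otimes> v = (v \<otimes> y) \<otimes> r \<oplus> u \<otimes> v"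
      using xy uv(1,2) r by algebra
    then have 1: "y \<otimes> r \<oplus> u \<in> zero_divisors R"
      using xy uv r by (intro zero_divisorsI[of _ v]) auto
    have "(x \<otimes> r \<ominus> u) \<otimes> y = (x \<otimes> y) \<otimes> r \<ominus> u \<otimes> y"
      using xy(1,2) uv(1,2) r by algebra
    then have 2: "x \<otimes> r \<ominus> u \<in> zero_divisors R"
      using xy uv r by (intro zero_divisorsI[of _ y]) (auto simp: a_minus_def)
    have "(y \<otimes> r \<oplus> u) \<oplus> (x \<otimes> r \<ominus> u) = r \<otimes> ?s"
      using xy(1,2) uv(1) r by algebra
    then have "(y \<otimes> r \<oplus> u) \<oplus> (x \<otimes> r \<ominus> u) \<notin> zero_divisors R"
      using regular_mult[OF r, of ?s] s xy by simp
    then have 0: "(y \<otimes> r \<oplus> u) \<otimes> (x \<otimes> r \<ominus> u) = \<zero>"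
      using compl 1 2 unfolding complete_Gamma_tilde_iff by blast
    \<comment> \<open>A ring identity whose correction terms are multiples of \<open>x y\<close> and
      \<open>u y\<close>, both zero.\<close>
    have "r \<otimes> (?s \<otimes> u) \<ominus> u \<otimes> u
      = (y \<otimes> r \<oplus> u) \<otimes> (x \<otimes> r \<ominus> u) \<ominus> (x \<otimes> y) \<otimes> (r \<otimes> r) \<oplus> (u \<otimes> y) \<otimes> (r \<oplus> r)"
      using xy(1,2) uv(1) r by algebra
    then have "r \<otimes> (?s \<otimes> u) \<ominus> u \<otimes> u = \<zero>"
      using 0 xy uv r by (simp add: a_minus_def)
    then show ?thesis using xy uv r by simp
  qed
  have su: "u \<otimes> u = ?s \<otimes> u" using eq[of \<one>] one_regular xy uv by simp
  show ru: "r \<otimes> u = u" if r: "r \<in> carrier R" "r \<notin> zero_divisors R" for r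
  proof -
    have "?s \<otimes> (r \<otimes> u) = r \<otimes> (?s \<otimes> u)" using xy(1,2) uv(1) r by algebra
    then have "?s \<otimes> (r \<otimes> u) = ?s \<otimes> u" using eq[OF r] su by simp
    then show ?thesis using regular_cancel_eq[of ?s "r \<otimes> u" u] s xy uv r by simp
  qed
  show "u \<otimes> u = u" using su ru[of ?s] s xy by simp
qed

text \<open>In \<open>A \<times> B\<close>, the hypotheses on \<open>u\<close> and \<open>v\<close> say that \<open>A\<close> is not a domain.\<close>

lemma boolean_of_complete:
  assumes compl: "complete_graph (Gamma_tilde R)"
    and xy: "x \<in> carrier R" "y \<in> carrier R" "x \<otimes> y = \<zero>" "y \<noteq> \<zero>"
    and s: "x \<oplus> y \<notin> zero_divisors R"
    and uv: "u \<in> carrier R" "v \<in> carrier R" "u \<otimes> y = \<zero>" "v \<otimes> y = \<zero>" "u \<otimes> v = \<zero>"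
      "u \<noteq> \<zero>" "v \<noteq> \<zero>"
  shows "boolean_ring R"
proof -
  let ?s = "x \<oplus> y"
  note idem = idempotent_of_complete[OF compl xy s]
  have vu: "v \<otimes> u = \<zero>" using uv by (simp add: m_comm)
  have sc: "?s \<in> carrier R" using xy by simp
  have uu: "u \<otimes> u = u" by (rule idem(1)[OF uv(1-5,7)])
  \<comment> \<open>The regular element is \<open>x + y\<close> itself. As \<open>y\<close> kills
    \<open>u\<close> and \<open>v\<close>, it follows below that \<open>x\<close> fixes
    both.\<close>
  have su: "?s \<otimes> u = u" by (rule idem(2)[OF uv(1-5,7) sc s])
  have sv: "?s \<otimes> v = v" by (rule idem(2)[OF uv(2,1,4,3) vu uv(6) sc s])
  have xu: "x \<otimes> u = u"
  proof -
    have "?s \<otimes> u = x \<otimes> u \<oplus> u \<otimes> y" using xy(1,2) uv(1) by algebra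
    then show ?thesis using su uv xy by simp
  qed
  have xv: "x \<otimes> v = v"
  proof -
    have "?s \<otimes> v = x \<otimes> v \<oplus> v \<otimes> y" using xy(1,2) uv(2) by algebra
    then show ?thesis using sv uv xy by simp
  qed
  \<comment> \<open>The complement of the idempotent \<open>u\<close> in the factor
    \<open>A\<close>, where \<open>x\<close> acts as the identity. It is a partner of
    \<open>u\<close> with \<open>u w = 0\<close>, and it is nonzero because \<open>x = u\<close>
    would give \<open>v = x v = u v = 0\<close>.\<close>
  define w where "w = x \<ominus> u"
  have w: "w \<in> carrier R" using xy uv by (simp add: w_def)
  have wy: "w \<otimes> y = \<zero>"
  proof -
    have "w \<otimes> y = x \<otimes> y \<ominus> u \<otimes> y" unfolding w_def using xy(1,2) uv(1) by algebra
    then show ?thesis using xy uv by (simp add: a_minus_def)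
  qed
  have wu: "w \<otimes> u = \<zero>"
  proof -
    have "w \<otimes> u = x \<otimes> u \<ominus> u \<otimes> u" unfolding w_def using xy(1,2) uv(1) by algebra
    then show ?thesis using xu uu uv by (simp add: a_minus_def r_neg)
  qed
  then have uw: "u \<otimes> w = \<zero>" using uv w by (simp add: m_comm)
  have w0: "w \<noteq> \<zero>"
  proof
    assume "w = \<zero>"
    then have "x = u" using xy uv by (simp add: w_def)
    then have "u \<otimes> v = v" using xv by simp
    then show False using uv by simp
  qed
  \<comment> \<open>The \<open>A\<close> side: \<open>x = u + w\<close>, and both \<open>b u\<close>
    and \<open>b w\<close> are idempotent by \<open>idem(1)\<close>, with \<open>w\<close> and
    \<open>u\<close> respectively in the role of \<open>v\<close>.\<close>
  have bx: "b \<otimes> b \<otimes> x = b \<otimes> x" if b: "b \<in> carrier R" for b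
  proof -
    have yc: "b \<otimes> u \<otimes> y = \<zero>" "b \<otimes> w \<otimes> y = \<zero>" and c: "b \<otimes> u \<otimes> w = \<zero>" "b \<otimes> w \<otimes> u = \<zero>"
      using b uv w wy wu uw xy by (simp_all add: m_assoc)
    have bu: "(b \<otimes> u) \<otimes> (b \<otimes> u) = b \<otimes> u"
      by (rule idem(1)[OF _ w yc(1) wy c(1) w0]) (use b uv in simp)
    have bw: "(b \<otimes> w) \<otimes> (b \<otimes> w) = b \<otimes> w"
      by (rule idem(1)[OF _ uv(1) yc(2) uv(3) c(2) uv(6)]) (use b w in simp)
    have ww: "w \<otimes> w = w"
      by (rule idem(1)[OF w uv(1) wy uv(3) wu uv(6)])
    have "b \<otimes> b \<otimes> x = b \<otimes> b \<otimes> u \<oplus> b \<otimes> b \<otimes> w"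
      unfolding w_def using b uv(1) xy(1) by algebra
    also have "\<dots> = b \<otimes> b \<otimes> (u \<otimes> u) \<oplus> b \<otimes> b \<otimes> (w \<otimes> w)"
      by (simp add: uu ww)
    also have "\<dots> = (b \<otimes> u) \<otimes> (b \<otimes> u) \<oplus> (b \<otimes> w) \<otimes> (b \<otimes> w)"
      using b uv(1) w by algebra
    also have "\<dots> = b \<otimes> u \<oplus> b \<otimes> w" by (simp add: bu bw)
    also have "\<dots> = b \<otimes> x"
      unfolding w_def using b uv(1) xy(1) by algebra
    finally show ?thesis .
  qed
  \<comment> \<open>The \<open>B\<close> side: with \<open>c = 1 - b\<close>, the elements
    \<open>u + b y\<close> and \<open>w + c y\<close> are killed by \<open>v\<close> and
    \<open>u\<close> and add up to the regular \<open>x + y\<close>, so their product is zero. All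
    that survives of it is \<open>b c y y\<close>.\<close>
  have b_y: "b \<otimes> b \<otimes> y = b \<otimes> y" if b: "b \<in> carrier R" for b
  proof -
    define c where "c = \<one> \<ominus> b"
    have c: "c \<in> carrier R" using b by (simp add: c_def)
    have "(u \<oplus> b \<otimes> y) \<otimes> v = u \<otimes> v \<oplus> b \<otimes> (v \<otimes> y)" using b xy(1,2) uv(1,2) by algebra
    then have 1: "u \<oplus> b \<otimes> y \<in> zero_divisors R"
      using b xy uv by (intro zero_divisorsI[of _ v]) auto
    have "(w \<oplus> c \<otimes> y) \<otimes> u = w \<otimes> u \<oplus> c \<otimes> (u \<otimes> y)" using c w xy(1,2) uv(1,2) by algebra
    then have 2: "w \<oplus> c \<otimes> y \<in> zero_divisors R"
      using c w wu xy uv by (intro zero_divisorsI[of _ u]) auto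
    have "(u \<oplus> b \<otimes> y) \<oplus> (w \<oplus> c \<otimes> y) = ?s"
      unfolding w_def c_def using b xy(1,2) uv(1) by algebra
    then have 0: "(u \<oplus> b \<otimes> y) \<otimes> (w \<oplus> c \<otimes> y) = \<zero>"
      using compl 1 2 s unfolding complete_Gamma_tilde_iff by metis
    have "(u \<oplus> b \<otimes> y) \<otimes> (w \<oplus> c \<otimes> y)
      = w \<otimes> u \<oplus> c \<otimes> (u \<otimes> y) \<oplus> b \<otimes> (w \<otimes> y) \<oplus> b \<otimes> c \<otimes> (y \<otimes> y)"
      using b c w xy(1,2) uv(1) by algebra
    then have "b \<otimes> c \<otimes> (y \<otimes> y) = \<zero>"
      using 0 b c w wu wy xy uv by simp
    \<comment> \<open>\<open>y\<close> is a zero-divisor and cannot be cancelled from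
      \<open>b c y y\<close>. But \<open>(x + y) y = y y\<close>, and \<open>x + y\<close>
      can.\<close>
    moreover have "?s \<otimes> (b \<otimes> c \<otimes> y) = b \<otimes> c \<otimes> (x \<otimes> y) \<oplus> b \<otimes> c \<otimes> (y \<otimes> y)"
      using b c xy(1,2) by algebra
    ultimately have "?s \<otimes> (b \<otimes> c \<otimes> y) = \<zero>" using b c xy by simp
    then have "b \<otimes> c \<otimes> y = \<zero>" using regular_cancel[of ?s] b c xy s by simp
    moreover have "b \<otimes> c \<otimes> y = b \<otimes> y \<ominus> b \<otimes> b \<otimes> y"
      unfolding c_def using b xy(2) by algebra
    ultimately show ?thesis using b xy by simp
  qed
  have "b \<otimes> b = b" if b: "b \<in> carrier R" for b
  proof -
    \<comment> \<open>The two sides are glued by multiplying with \<open>x + y\<close>, which is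
      then cancelled.\<close>
    have "?s \<otimes> (b \<otimes> b) = b \<otimes> b \<otimes> x \<oplus> b \<otimes> b \<otimes> y" using b xy(1,2) by algebra
    also have "\<dots> = b \<otimes> x \<oplus> b \<otimes> y" by (simp add: bx b_y b)
    also have "\<dots> = ?s \<otimes> b" using b xy(1,2) by algebra
    finally show ?thesis using regular_cancel_eq[of ?s "b \<otimes> b" b] b xy s by simp
  qed
  then show ?thesis by (auto simp: boolean_ring_def numeral_2_eq_2 ring_axioms)
qed

text \<open>If \<open>a b\<close> kills \<open>x\<close> but neither \<open>a\<close> nor
  \<open>b\<close> does, then \<open>u = a x\<close> and \<open>v = b x\<close> are nonzero, have
  product zero and are killed by \<open>y\<close>, so \<open>boolean_of_complete\<close>
  applies.\<close>

lemma annihilator_prime_or_boolean: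
  assumes compl: "complete_graph (Gamma_tilde R)"
    and xy: "x \<in> carrier R" "y \<in> carrier R" "x \<otimes> y = \<zero>" "x \<noteq> \<zero>" "y \<noteq> \<zero>"
    and s: "x \<oplus> y \<notin> zero_divisors R"
  shows "primeideal {a \<in> carrier R. a \<otimes> x = \<zero>} R \<or> boolean_ring R"
proof (rule disjCI)
  assume nb: "\<not> boolean_ring R"
  show "primeideal {a \<in> carrier R. a \<otimes> x = \<zero>} R"
  proof (rule primeidealI[OF annihilator_ideal[OF xy(1)] cring_axioms])
    show "carrier R \<noteq> {a \<in> carrier R. a \<otimes> x = \<zero>}"
    proof
      assume "carrier R = {a \<in> carrier R. a \<otimes> x = \<zero>}"
      then have "\<one> \<otimes> x = \<zero>" using one_closed by blast
      then show False using xy by simp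
    qed
    fix a b assume ab: "a \<in> carrier R" "b \<in> carrier R" "a \<otimes> b \<in> {a \<in> carrier R. a \<otimes> x = \<zero>}"
    have "(a \<otimes> x) \<otimes> (b \<otimes> x) = x \<otimes> (a \<otimes> b \<otimes> x)" using ab(1,2) xy(1) by algebra
    then have "(a \<otimes> x) \<otimes> (b \<otimes> x) = \<zero>" using ab xy by simp
    moreover have "a \<otimes> x \<otimes> y = \<zero>" "b \<otimes> x \<otimes> y = \<zero>" using ab xy by (simp_all add: m_assoc)
    ultimately have "a \<otimes> x = \<zero> \<or> b \<otimes> x = \<zero>"
      using boolean_of_complete[OF compl xy(1,2,3,5) s, of "a \<otimes> x" "b \<otimes> x"] nb ab xy by auto
    then show "a \<in> {a \<in> carrier R. a \<otimes> x = \<zero>} \<or> b \<in> {a \<in> carrier R. a \<otimes> x = \<zero>}"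
      using ab by blast
  qed
qed

end

theorem theorem1p7:
  fixes R :: "('a, 'm) ring_scheme" (structure)
  assumes "cring R" and "\<one> \<noteq> \<zero>"
  shows "complete_graph (Gamma_tilde R) \<longleftrightarrow>
    boolean_ring R \<or> ideal (zero_divisors R) R \<or> subring_of_two_domains R"
proof
  interpret cring R by fact
  assume "boolean_ring R \<or> ideal (zero_divisors R) R \<or> subring_of_two_domains R"
  then show "complete_graph (Gamma_tilde R)"
    unfolding complete_Gamma_tilde_iff ideal_zero_divisors_iff[OF assms(2)]
    using boolean_sum_or_mult subring_of_two_domains_sum_or_mult zero_divisors_closed by blast
next
  interpret cring R by fact
  assume compl: "complete_graph (Gamma_tilde R)"
  show "boolean_ring R \<or> ideal (zero_divisors R) R \<or> subring_of_two_domains R"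
  proof (cases "ideal (zero_divisors R) R")
    case False
    then obtain x y where Z: "x \<in> zero_divisors R" "y \<in> zero_divisors R"
      and s: "x \<oplus> y \<notin> zero_divisors R"
      unfolding ideal_zero_divisors_iff[OF assms(2)] by blast
    note c = Z[THEN zero_divisors_closed]
    have xy: "x \<otimes> y = \<zero>" using compl Z s unfolding complete_Gamma_tilde_iff by blast
    have nz: "x \<noteq> \<zero>" "y \<noteq> \<zero>" using Z s c by auto
    let ?P = "{a \<in> carrier R. a \<otimes> x = \<zero>}" and ?Q = "{a \<in> carrier R. a \<otimes> y = \<zero>}"
    \<comment> \<open>The situation is symmetric in \<open>x\<close> and \<open>y\<close>, so the
      second annihilator is handled by exchanging them.\<close>
    have "primeideal ?P R \<or> boolean_ring R" "primeideal ?Q R \<or> boolean_ring R"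
      using annihilator_prime_or_boolean[OF compl c xy nz s]
        annihilator_prime_or_boolean[OF compl c(2,1) _ nz(2,1)] xy s c
      by (simp_all add: m_comm a_comm)
    moreover have "?P \<inter> ?Q = {\<zero>}"
    proof -
      \<comment> \<open>Such an \<open>a\<close> kills the regular element
        \<open>x + y\<close>.\<close>
      have "a = \<zero>" if "a \<in> carrier R" "a \<otimes> x = \<zero>" "a \<otimes> y = \<zero>" for a
        using that c s regular_cancel[of "x \<oplus> y" a] by (simp add: m_comm[of _ a] r_distr)
      then show ?thesis using c by auto
    qed
    ultimately show ?thesis using subring_of_two_domains_quotients by blast
  qed simp
qed

end
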